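(* Let $q$ be an odd prime, let $r\in[1,q-1]$ be an integer such that $r^2\equiv -1\pmod q$, and let $$G=\langle \alpha,\tau:\ \alpha^q=1,\ \tau^4=1,\ \alpha\tau=\tau\alpha^r\rangle.$$ Then $\mathsf d(G)=q+2$.
   Context: A sequence over a finite group $G$ is a finite unordered list of elements of $G$ with repetition allowed; its length is its number of terms with multiplicity; a subsequence is a sub-multiset. A sequence is product-one if its terms can be ordered so that their product is the identity. The small Davenport constant $\mathsf d(G)$ is the maximal integer $\ell$ such that there is a sequence over $G$ of length $\ell$ having no nonempty product-one subsequence. *)

theory Defs
  imports
    "HOL-Algebra.Group"
    "HOL-Library.Multiset"
    "HOL-Number_Theory.Cong"
    "HOL-Computational_Algebra.Primes"
begin

text \<open>Words over an alphabet of generators and their formal inverses: the letter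
  \<open>(x, True)\<close> stands for \<open>x\<close> and \<open>(x, False)\<close> for its inverse.\<close>

type_synonym 'a gword = "('a \<times> bool) list"

definition gpow :: "'a \<Rightarrow> nat \<Rightarrow> 'a gword" where
  "gpow x n = replicate n (x, True)"

text \<open>A relation \<open>l = r\<close> of a presentation is a pair \<open>(l, r)\<close> of words. The following is
  the least congruence on words containing the free cancellations and the given relations.\<close>

inductive pres_eq :: "('a gword \<times> 'a gword) set \<Rightarrow> 'a gword \<Rightarrow> 'a gword \<Rightarrow> bool"
  for R where
  refl: "pres_eq R u u"
| sym: "pres_eq R u v \<Longrightarrow> pres_eq R v u"
| trans: "pres_eq R u v \<Longrightarrow> pres_eq R v w \<Longrightarrow> pres_eq R u w"
| cancel: "pres_eq R (u @ [(x, b), (x, \<not> b)] @ v) (u @ v)"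
| relation: "(l, r) \<in> R \<Longrightarrow> pres_eq R (u @ l @ v) (u @ r @ v)"

definition pres_class :: "('a gword \<times> 'a gword) set \<Rightarrow> 'a gword \<Rightarrow> 'a gword set" where
  "pres_class R u = {v. pres_eq R u v}"

text \<open>The group with all elements of type \<open>'a\<close> as generators and with defining relations
  \<open>R\<close>, i.e. the free group on \<open>'a\<close> modulo \<open>R\<close>.\<close>

definition presented_group :: "('a gword \<times> 'a gword) set \<Rightarrow> 'a gword set monoid" where
  "presented_group R =
     \<lparr>carrier = range (pres_class R),
      monoid.mult = (\<lambda>A B. {w. \<exists>a\<in>A. \<exists>b\<in>B. pres_eq R (a @ b) w}),
      one = pres_class R []\<rparr>"

datatype gens = Alpha | Tau

definition G_pres :: "nat \<Rightarrow> nat \<Rightarrow> gens gword set monoid" where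
  "G_pres q r = presented_group
     {(gpow Alpha q, []),
      (gpow Tau 4, []),
      (gpow Alpha 1 @ gpow Tau 1, gpow Tau 1 @ gpow Alpha r)}"

definition product_one :: "('a, 'm) monoid_scheme \<Rightarrow> 'a multiset \<Rightarrow> bool" where
  "product_one G S \<longleftrightarrow>
     (\<exists>xs. mset xs = S \<and> foldr (\<lambda>x y. x \<otimes>\<^bsub>G\<^esub> y) xs \<one>\<^bsub>G\<^esub> = \<one>\<^bsub>G\<^esub>)"

definition product_one_free :: "('a, 'm) monoid_scheme \<Rightarrow> 'a multiset \<Rightarrow> bool" where
  "product_one_free G S \<longleftrightarrow> (\<forall>T. T \<subseteq># S \<and> T \<noteq> {#} \<longrightarrow> \<not> product_one G T)"

text \<open>Meaningful for finite \<open>G\<close>, where the lengths in question are bounded.\<close>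

definition small_davenport :: "('a, 'm) monoid_scheme \<Rightarrow> nat" where
  "small_davenport G =
     (GREATEST l. \<exists>S. set_mset S \<subseteq> carrier G \<and> size S = l \<and> product_one_free G S)"

subsection \<open>The presented group is a group and has the universal property\<close>

lemma pres_eq_context: "pres_eq R u v \<Longrightarrow> pres_eq R (p @ u @ s) (p @ v @ s)"
proof (induction rule: pres_eq.induct)
  case (cancel u x b v)
  show ?case using pres_eq.cancel[of R "p @ u" x b "v @ s"] by simp
next
  case (relation l r u v)
  then show ?case using pres_eq.relation[of l r R "p @ u" "v @ s"] by simp
qed (blast intro: pres_eq.intros)+

lemma pres_eq_append: "pres_eq R u u' \<Longrightarrow> pres_eq R v v' \<Longrightarrow> pres_eq R (u @ v) (u' @ v')"
  using pres_eq_context[of R u u' "[]" v] pres_eq_context[of R v v' u' "[]"]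
  by (auto intro: pres_eq.trans)

lemma pres_class_eq_iff: "pres_class R u = pres_class R v \<longleftrightarrow> pres_eq R u v"
  unfolding pres_class_def by (blast intro: pres_eq.intros)

lemma presented_group_mult:
  "pres_class R u \<otimes>\<^bsub>presented_group R\<^esub> pres_class R v = pres_class R (u @ v)"
  unfolding presented_group_def pres_class_def
  by (auto intro: pres_eq.refl pres_eq.trans pres_eq_append)

lemma presented_group_one: "\<one>\<^bsub>presented_group R\<^esub> = pres_class R []"
  by (simp add: presented_group_def)

lemma presented_group_carrier: "carrier (presented_group R) = range (pres_class R)"
  by (simp add: presented_group_def)

definition inv_gword :: "'a gword \<Rightarrow> 'a gword" where
  "inv_gword w = rev (map (\<lambda>(x, b). (x, \<not> b)) w)"

lemma pres_eq_inv_gword: "pres_eq R (inv_gword w @ w) []"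
proof (induction w)
  case Nil
  show ?case by (simp add: inv_gword_def pres_eq.refl)
next
  case (Cons a w)
  obtain x b where a: "a = (x, b)" by (cases a)
  have "pres_eq R (inv_gword w @ [(x, \<not> b), (x, \<not> \<not> b)] @ w) (inv_gword w @ w)"
    by (rule pres_eq.cancel)
  then have "pres_eq R (inv_gword (a # w) @ a # w) (inv_gword w @ w)"
    by (simp add: inv_gword_def a)
  then show ?case using Cons.IH by (rule pres_eq.trans)
qed

lemma group_presented_group: "group (presented_group R)"
proof (rule groupI)
  fix x assume "x \<in> carrier (presented_group R)"
  then obtain u where "x = pres_class R u" by (auto simp: presented_group_carrier)
  then show "\<exists>y\<in>carrier (presented_group R).
      y \<otimes>\<^bsub>presented_group R\<^esub> x = \<one>\<^bsub>presented_group R\<^esub>"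
    by (intro bexI[of _ "pres_class R (inv_gword u)"])
      (auto simp: presented_group_carrier presented_group_mult presented_group_one
        pres_class_eq_iff pres_eq_inv_gword)
qed (auto simp: presented_group_carrier presented_group_mult presented_group_one)

definition eval_gword :: "('b, 'm) monoid_scheme \<Rightarrow> ('a \<Rightarrow> 'b) \<Rightarrow> 'a gword \<Rightarrow> 'b" where
  "eval_gword H f w =
     foldr (\<lambda>(x, b) y. (if b then f x else inv\<^bsub>H\<^esub> f x) \<otimes>\<^bsub>H\<^esub> y) w \<one>\<^bsub>H\<^esub>"

lemma eval_gword_closed:
  assumes "group H" "\<And>x. f x \<in> carrier H"
  shows "eval_gword H f w \<in> carrier H"
proof -
  interpret group H by fact
  show ?thesis by (induction w) (auto simp: eval_gword_def assms(2))
qed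

lemma eval_gword_append:
  assumes "group H" "\<And>x. f x \<in> carrier H"
  shows "eval_gword H f (u @ v) = eval_gword H f u \<otimes>\<^bsub>H\<^esub> eval_gword H f v"
proof -
  interpret group H by fact
  note cl = eval_gword_closed[of H f, OF assms]
  show ?thesis
  proof (induction u)
    case Nil
    show ?case using cl[of v] by (simp add: eval_gword_def)
  next
    case (Cons a u)
    then show ?case using cl[of u] cl[of v] assms(2)
      by (cases a) (simp add: eval_gword_def m_assoc)
  qed
qed

lemma eval_gword_pres_eq:
  assumes "group H" "\<And>x. f x \<in> carrier H"
    and R: "\<And>l r. (l, r) \<in> R \<Longrightarrow> eval_gword H f l = eval_gword H f r"
    and "pres_eq R u v"
  shows "eval_gword H f u = eval_gword H f v"
proof -
  interpret group H by fact
  note cl = eval_gword_closed[of H f, OF assms(1,2)]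
  note app = eval_gword_append[of H f, OF assms(1,2)]
  show ?thesis using assms(4)
  proof (induction rule: pres_eq.induct)
    case (cancel u x b v)
    have "eval_gword H f [(x, b), (x, \<not> b)] = \<one>\<^bsub>H\<^esub>"
      using assms(2)[of x] by (cases b) (simp_all add: eval_gword_def)
    then show ?case using cl by (simp only: app l_one)
  next
    case (relation l r u v)
    then show ?case using R by (simp add: app)
  qed simp_all
qed

lemma presented_group_universal:
  assumes "group H" "\<And>x. f x \<in> carrier H"
    and "\<And>l r. (l, r) \<in> R \<Longrightarrow> eval_gword H f l = eval_gword H f r"
  shows "\<exists>h \<in> hom (presented_group R) H. \<forall>w. h (pres_class R w) = eval_gword H f w"
proof -
  define h where "h A = eval_gword H f (SOME w. A = pres_class R w)" for A
  have h: "h (pres_class R w) = eval_gword H f w" for w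
  proof -
    have "pres_class R w = pres_class R (SOME v. pres_class R w = pres_class R v)"
      by (rule someI[of _ w]) simp
    then have "pres_eq R w (SOME v. pres_class R w = pres_class R v)"
      by (simp only: pres_class_eq_iff)
    then show ?thesis
      unfolding h_def using eval_gword_pres_eq[of H f R, OF assms] by metis
  qed
  have "h \<in> hom (presented_group R) H"
    by (auto simp: hom_def presented_group_carrier presented_group_mult h
        eval_gword_closed[of H f, OF assms(1,2)] eval_gword_append[of H f, OF assms(1,2)])
  then show ?thesis using h by blast
qed

end

theory Submission
  imports Defs "HOL-Algebra.Multiplicative_Group"
begin

text \<open>Let \<open>N = \<langle>\<alpha>\<rangle>\<close>: an abelian normal subgroup in which no element other than \<open>1\<close> commutes with
  an element outside \<open>N\<close>. As long as at least \<open>[G : N]\<close> terms remain, some block of terms has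
  product in \<open>N\<close>; split off a shortest such block. Its rotations have conjugate products, which
  are pairwise distinct, so a block of length \<open>l\<close> yields \<open>l\<close> products in \<open>N\<close>. If no subsequence
  is product-one, then by Scherk's theorem each block enlarges the set of products in \<open>N\<close> of
  subsequences (including the empty one) by at least \<open>l\<close>. That set has at most \<open>|N|\<close> elements, so
  the sequence has length at most \<open>|N| - 1 + [G : N] - 1 = q + 2\<close>. The sequence consisting of
  \<open>q - 1\<close> copies of \<open>\<alpha>\<close> and three copies of \<open>\<tau>\<close> attains this bound.\<close>

section \<open>Scherk's theorem in abelian groups\<close>

text \<open>Scherk's theorem, by Dyson's transform: if \<open>a \<in> A\<close> and \<open>b \<in> B\<close> with \<open>a b \<notin> A\<close>, move to \<open>A\<close> the
  translates \<open>a x \<notin> A\<close> of the \<open>x \<in> B\<close> and delete those \<open>x\<close> from \<open>B\<close>.\<close>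

lemma (in comm_group) card_set_mult_ge:
  assumes "finite A" "finite B" "A \<subseteq> carrier G" "B \<subseteq> carrier G" "\<one> \<in> A" "\<one> \<in> B"
    and "\<And>a b. a \<in> A \<Longrightarrow> b \<in> B \<Longrightarrow> a \<otimes> b = \<one> \<Longrightarrow> a = \<one>"
  shows "card A + card B \<le> card (A <#> B) + 1"
  using assms
proof (induction "card B" arbitrary: A B rule: less_induct)
  case less
  note fin = less.prems(1,2) and sub = less.prems(3,4) and one = less.prems(5,6)
    and triv = less.prems(7)
  show ?case
  proof (cases "B = {\<one>}")
    case True
    then have "A <#> B = A" using sub by (force simp: set_mult_def)
    then show ?thesis using True by simp
  next
    case False
    then obtain b where b: "b \<in> B" "b \<noteq> \<one>" using one by blast
    \<comment> \<open>Otherwise translation by \<open>b\<close> permutes the finite set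
      \<open>A\<close>, so it hits \<open>\<one>\<close>. Then \<open>a \<otimes> b = \<one>\<close>
      for some \<open>a\<close> in \<open>A\<close>, and \<open>triv\<close> gives
      \<open>a = \<one>\<close>, whence \<open>b = \<one>\<close>.\<close>
    have "\<exists>a\<in>A. a \<otimes> b \<notin> A"
    proof (rule ccontr)
      assume "\<not> ?thesis"
      then have "(\<lambda>a. a \<otimes> b) ` A \<subseteq> A" by auto
      moreover have "inj_on (\<lambda>a. a \<otimes> b) A"
        using sub b by (intro inj_onI) (metis right_cancel subsetD)
      ultimately have "(\<lambda>a. a \<otimes> b) ` A = A" using fin(1) by (intro endo_inj_surj)
      then obtain a where "a \<in> A" "a \<otimes> b = \<one>" using one(1) by (metis imageE)
      then show False using triv[of a b] b sub by auto
    qed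
    then obtain a where a: "a \<in> A" "a \<otimes> b \<notin> A" by blast
    have ac: "a \<in> carrier G" using a sub by auto
    define B' where "B' = {x \<in> B. a \<otimes> x \<in> A}"
    define C where "C = (\<lambda>x. a \<otimes> x) ` (B - B')"
    have B'B: "B' \<subseteq> B" by (auto simp: B'_def)
    have "b \<notin> B'" using a by (simp add: B'_def)
    then have lt: "card B' < card B" using b(1) B'B fin(2) by (intro psubset_card_mono) auto
    have "inj_on (\<lambda>x. a \<otimes> x) (B - B')"
      using sub ac by (intro inj_onI) (metis DiffE Units_eq Units_l_cancel subsetD)
    then have "card C = card (B - B')" by (simp add: C_def card_image)
    \<comment> \<open>The transform preserves the sum of the two cardinalities: \<open>A\<close>
      gains exactly as many elements as \<open>B\<close> loses.\<close>
    then have cC: "card C + card B' = card B"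
      using fin(2) B'B by (simp add: card_Diff_subset finite_subset card_mono)
    have "A \<inter> C = {}" by (auto simp: C_def B'_def)
    then have cA: "card (A \<union> C) = card A + card C"
      using fin by (simp add: card_Un_disjoint C_def)
    have "card (A \<union> C) + card B' \<le> card ((A \<union> C) <#> B') + 1"
    proof (rule less.hyps[OF lt])
      show "finite (A \<union> C)" "finite B'" using fin by (auto simp: C_def B'_def)
      show "A \<union> C \<subseteq> carrier G" "B' \<subseteq> carrier G" using sub ac by (auto simp: C_def B'_def)
      show "\<one> \<in> A \<union> C" "\<one> \<in> B'" using one a ac by (auto simp: B'_def)
    next
      \<comment> \<open>The triviality condition survives the transform. For a new element
        \<open>x = a \<otimes> z\<close>, regroup \<open>x \<otimes> y\<close> as
        \<open>(a \<otimes> y) \<otimes> z\<close>; membership of \<open>y\<close> in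
        \<open>B'\<close> puts \<open>a \<otimes> y\<close> in \<open>A\<close>, so
        \<open>triv\<close> applies to this product and then to \<open>a \<otimes> y\<close>
        itself.\<close>
      fix x y assume xy: "x \<in> A \<union> C" "y \<in> B'" "x \<otimes> y = \<one>"
      show "x = \<one>"
      proof (cases "x \<in> A")
        case True
        then show ?thesis using xy B'B triv by blast
      next
        case False
        then obtain z where z: "z \<in> B" "x = a \<otimes> z" using xy by (auto simp: C_def)
        have zy: "z \<in> carrier G" "y \<in> carrier G" using z xy B'B sub by auto
        have "(a \<otimes> y) \<otimes> z = \<one>" using xy(3) z zy ac by (simp add: m_ac)
        moreover have "a \<otimes> y \<in> A" using xy by (simp add: B'_def)
        ultimately have ay: "a \<otimes> y = \<one>" using triv z by blast
        then have "z = \<one>" using \<open>(a \<otimes> y) \<otimes> z = \<one>\<close> zy by simp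
        moreover have "a = \<one>" using triv ay a xy B'B by blast
        ultimately show ?thesis using z by simp
      qed
    qed
    \<comment> \<open>The same regrouping shows that the transform creates no new products.\<close>
    moreover have "(A \<union> C) <#> B' \<subseteq> A <#> B"
    proof
      fix w assume "w \<in> (A \<union> C) <#> B'"
      then obtain x y where xy: "x \<in> A \<union> C" "y \<in> B'" "w = x \<otimes> y" by (auto simp: set_mult_def)
      show "w \<in> A <#> B"
      proof (cases "x \<in> A")
        case True
        then show ?thesis using xy B'B by (auto simp: set_mult_def)
      next
        case False
        then obtain z where z: "z \<in> B" "x = a \<otimes> z" using xy by (auto simp: C_def)
        have "z \<in> carrier G" "y \<in> carrier G" using z xy B'B sub by auto
        then have "w = (a \<otimes> y) \<otimes> z" using xy(3) z ac by (simp add: m_ac)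
        moreover have "a \<otimes> y \<in> A" using xy by (simp add: B'_def)
        ultimately show ?thesis using z by (auto simp: set_mult_def)
      qed
    qed
    moreover have "finite (A <#> B)" using fin by (auto simp: set_mult_def)
    ultimately show ?thesis using cA cC card_mono[of "A <#> B" "(A \<union> C) <#> B'"] by linarith
  qed
qed

section \<open>Blocks with product in a normal subgroup\<close>

lemma mset_rotate [simp]: "mset (rotate k xs) = mset xs"
  by (metis append_take_drop_id mset_append rotate_drop_take union_commute)

lemma mset_take_subseteq: "mset (take k xs) \<subseteq># mset xs"
  and mset_drop_subseteq: "mset (drop k xs) \<subseteq># mset xs"
  by (metis append_take_drop_id mset_append mset_subset_eq_add_left mset_subset_eq_add_right)+

abbreviation list_prod :: "('a, 'm) monoid_scheme \<Rightarrow> 'a list \<Rightarrow> 'a" where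
  "list_prod G xs \<equiv> foldr (\<lambda>x y. x \<otimes>\<^bsub>G\<^esub> y) xs \<one>\<^bsub>G\<^esub>"

lemma (in monoid) list_prod_closed: "set xs \<subseteq> carrier G \<Longrightarrow> list_prod G xs \<in> carrier G"
  by (induction xs) auto

lemma (in monoid) list_prod_append:
  "set xs \<subseteq> carrier G \<Longrightarrow> set ys \<subseteq> carrier G \<Longrightarrow>
    list_prod G (xs @ ys) = list_prod G xs \<otimes> list_prod G ys"
  by (induction xs) (auto simp: list_prod_closed m_assoc)

text \<open>Pigeonhole on prefix products: there are \<open>length xs + 1\<close> prefixes, counting
  the empty one, but at most \<open>length xs\<close> cosets. The terms between two prefixes in the
  same coset form the block.\<close>

lemma (in normal) exists_block_in_subgroup:
  assumes "finite (rcosets H)" "set xs \<subseteq> carrier G" "card (rcosets H) \<le> length xs"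
  shows "\<exists>ys. mset ys \<subseteq># mset xs \<and> ys \<noteq> [] \<and> list_prod G ys \<in> H"
proof -
  let ?f = "\<lambda>i. H #> list_prod G (take i xs)"
  have cl: "set (take i xs) \<subseteq> carrier G" for i using assms(2) set_take_subset[of i xs] by blast
  have "?f ` {..length xs} \<subseteq> rcosets H"
    using cl by (auto simp: RCOSETS_def intro!: list_prod_closed)
  then have "card (?f ` {..length xs}) \<le> length xs"
    using assms(1,3) card_mono by (meson le_trans)
  then have "\<not> inj_on ?f {..length xs}" by (auto dest: card_image)
  then obtain i j where ij: "i < j" "j \<le> length xs" "?f i = ?f j"
    unfolding inj_on_def by (metis atMost_iff linorder_neqE_nat)
  define ys where "ys = drop i (take j xs)"
  have tj: "take j xs = take i xs @ ys"
    using ij(1) by (simp add: ys_def) (metis append_take_drop_id min.absorb3 take_take)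
  have ycl: "set ys \<subseteq> carrier G" using cl[of j] tj by auto
  define x y where "x = list_prod G (take i xs)" and "y = list_prod G ys"
  have xy: "x \<in> carrier G" "y \<in> carrier G" using cl ycl by (auto simp: x_def y_def list_prod_closed)
  have "list_prod G (take j xs) = x \<otimes> y"
    using cl ycl by (simp only: tj list_prod_append x_def y_def)
  then have "H #> x = H #> (x \<otimes> y)" using ij(3) by (simp add: x_def)
  \<comment> \<open>Equal right cosets only say that a conjugate of \<open>y\<close> lies in
    \<open>H\<close>. Normality turns them into left cosets, where \<open>x\<close> cancels and
    \<open>y\<close> itself is seen to lie in \<open>H\<close>.\<close>
  then have "x <# H = (x \<otimes> y) <# H" using coset_eq xy by simp
  moreover have "x \<otimes> y \<in> (x \<otimes> y) <# H" using xy one_closed by (force simp: l_coset_def)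
  ultimately obtain h where "h \<in> H" "x \<otimes> y = x \<otimes> h" by (auto simp: l_coset_def)
  then have "y \<in> H" using xy by (metis Units_eq Units_l_cancel mem_carrier)
  moreover have "mset ys \<subseteq># mset xs"
    unfolding ys_def by (metis mset_drop_subseteq mset_take_subseteq subset_mset.trans)
  moreover have "ys \<noteq> []" using ij by (simp add: ys_def)
  ultimately show ?thesis by (auto simp: y_def)
qed

text \<open>Rotating turns a product \<open>x \<otimes> y\<close> into \<open>y \<otimes> x\<close>,
  its conjugate by \<open>x\<close>.\<close>

lemma (in normal) rotate_list_prod:
  assumes "set xs \<subseteq> carrier G" "list_prod G xs \<in> H"
  shows "list_prod G (rotate i xs) \<in> H"
proof -
  define j where "j = i mod length xs"
  define x y where "x = list_prod G (take j xs)" and "y = list_prod G (drop j xs)"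
  have cl: "set (take j xs) \<subseteq> carrier G" "set (drop j xs) \<subseteq> carrier G"
    using assms(1) set_take_subset[of j xs] set_drop_subset[of j xs] by auto
  have xy: "x \<in> carrier G" "y \<in> carrier G" using cl by (auto simp: x_def y_def list_prod_closed)
  have "list_prod G xs = x \<otimes> y"
    using list_prod_append[OF cl] by (simp add: x_def y_def)
  then have "inv x \<otimes> (x \<otimes> y) \<otimes> x \<in> H" using assms(2) xy inv_op_closed1 by simp
  moreover have "inv x \<otimes> (x \<otimes> y) \<otimes> x = y \<otimes> x" using xy by (simp add: m_assoc[symmetric])
  moreover have "list_prod G (rotate i xs) = y \<otimes> x"
    using list_prod_append[OF cl(2,1)] by (simp add: rotate_drop_take j_def x_def y_def)
  ultimately show ?thesis by simp
qed

section \<open>The upper bound from an abelian normal subgroup\<close>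

text \<open>The rotations of a shortest block \<open>ys\<close> with product in \<open>H\<close> have distinct products: if
  \<open>y z = z y\<close> for a proper splitting, then \<open>y\<close> centralises the nontrivial element \<open>y z\<close> of \<open>H\<close>,
  so already \<open>y\<close> lies in \<open>H\<close>.\<close>

theorem (in normal) product_one_free_size_le:
  assumes comm: "comm_group (G\<lparr>carrier := H\<rparr>)" and finH: "finite H" and fin: "finite (rcosets H)"
    and cent: "\<And>p x. p \<in> H \<Longrightarrow> p \<noteq> \<one> \<Longrightarrow> x \<in> carrier G \<Longrightarrow> x \<otimes> p = p \<otimes> x \<Longrightarrow> x \<in> H"
    and "set_mset S \<subseteq> carrier G" "product_one_free G S"
  shows "size S + 2 \<le> card H + card (rcosets H)"
proof -
  define R where "R S = {list_prod G xs | xs. mset xs \<subseteq># S \<and> list_prod G xs \<in> H}" for S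
  have RH: "R S \<subseteq> H" for S by (auto simp: R_def)
  have one_R: "\<one> \<in> R S" for S by (auto simp: R_def intro!: exI[of _ "[]"])
  have "set_mset S \<subseteq> carrier G \<Longrightarrow> product_one_free G S \<Longrightarrow>
    size S + 2 \<le> card (R S) + card (rcosets H)" for S
  proof (induction "size S" arbitrary: S rule: less_induct)
    case less
    note Scl = less.prems(1) and free = less.prems(2)
    have free': "mset xs \<subseteq># S \<Longrightarrow> xs \<noteq> [] \<Longrightarrow> list_prod G xs \<noteq> \<one>" for xs
      using free unfolding product_one_free_def product_one_def
      by (metis mset_zero_iff)
    have finR: "finite (R S)" for S using finH RH finite_subset by blast
    show ?case
    \<comment> \<open>With too few terms to force a block, the empty product alone gives
      \<open>card (R S) \<ge> 1\<close>, which is enough.\<close>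
    proof (cases "size S < card (rcosets H)")
      case True
      moreover have "card (R S) > 0" using one_R[of S] finR[of S] by (auto simp: card_gt_0_iff)
      ultimately show ?thesis by simp
    next
      case False
      let ?P = "\<lambda>ys. mset ys \<subseteq># S \<and> ys \<noteq> [] \<and> list_prod G ys \<in> H"
      obtain xs where xs: "mset xs = S" using ex_mset by blast
      have "\<exists>ys. ?P ys"
        using exists_block_in_subgroup[of xs] fin False Scl xs
        by (force simp: size_mset[symmetric] simp del: size_mset)
      then obtain ys where ys: "?P ys" and minl: "\<And>zs. ?P zs \<Longrightarrow> length ys \<le> length zs"
        using ex_has_least_nat[of ?P _ length] by metis
      have cl: "mset zs \<subseteq># S \<Longrightarrow> set zs \<subseteq> carrier G" for zs
        using Scl by (metis set_mset_mono set_mset_mset subset_trans)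
      define A where "A = (\<lambda>i. list_prod G (rotate i ys)) ` {..<length ys}"
      have rot: "?P (rotate i ys)" for i
        using ys rotate_list_prod[OF cl] by simp
      \<comment> \<open>Stated for every shortest block \<open>zs\<close>, so that two rotations of
        \<open>ys\<close> can be compared by taking one of them as \<open>zs\<close> and rotating it
        by the difference of the indices.\<close>
      have step: "list_prod G (rotate d zs) \<noteq> list_prod G zs"
        if zs: "?P zs" "length zs = length ys" and d: "0 < d" "d < length ys" for zs d
      proof
        assume eq: "list_prod G (rotate d zs) = list_prod G zs"
        define x y where "x = list_prod G (take d zs)" and "y = list_prod G (drop d zs)"
        have sub: "mset (take d zs) \<subseteq># S" "mset (drop d zs) \<subseteq># S"
          using zs mset_take_subseteq mset_drop_subseteq subset_mset.trans by blast+
        note cls = cl[OF sub(1)] cl[OF sub(2)]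
        have xy: "x \<in> carrier G" "y \<in> carrier G" using cls by (auto simp: x_def y_def list_prod_closed)
        have p: "list_prod G zs = x \<otimes> y"
          using list_prod_append[OF cls] by (simp add: x_def y_def)
        have "list_prod G (rotate d zs) = y \<otimes> x"
          using list_prod_append[OF cls(2,1)] d zs(2) by (simp add: rotate_drop_take x_def y_def)
        then have "x \<otimes> (x \<otimes> y) = (x \<otimes> y) \<otimes> x" using eq p xy by (metis m_assoc)
        then have "x \<in> H" using cent[of "x \<otimes> y" x] xy p zs(1) free'[of zs] by simp
        then have "?P (take d zs)" using sub d zs by (auto simp: x_def)
        then show False using minl[of "take d zs"] d zs(2) by simp
      qed
      have inj: "inj_on (\<lambda>i. list_prod G (rotate i ys)) {..<length ys}"
      proof (rule linorder_inj_onI)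
        fix i j assume "i < j" "i \<in> {..<length ys}" "j \<in> {..<length ys}"
        moreover from this have "rotate j ys = rotate (j - i) (rotate i ys)"
          by (simp add: rotate_rotate)
        ultimately show "list_prod G (rotate i ys) \<noteq> list_prod G (rotate j ys)"
          using step[OF rot[of i], of "j - i"] by force
      qed auto
      have cA: "card A = length ys" using inj by (simp add: A_def card_image)
      have "\<one> \<notin> A"
      proof
        assume "\<one> \<in> A"
        then obtain i where "\<one> = list_prod G (rotate i ys)" by (auto simp: A_def)
        then show False using free'[of "rotate i ys"] rot[of i] by simp
      qed
      \<comment> \<open>The extra element \<open>\<one>\<close> offsets the \<open>+ 1\<close> in
        Scherk's bound, so \<open>R\<close> grows by the full length of the block.\<close>
      then have cB: "card (insert \<one> A) = length ys + 1" using cA by (simp add: A_def)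
      define S' where "S' = S - mset ys"
      have S: "S = S' + mset ys" using ys by (simp add: S'_def)
      have comb: "mset (us @ rotate i ys) \<subseteq># S" if "mset us \<subseteq># S'" for us i
        using that by (simp add: S)
      have clS': "mset us \<subseteq># S' \<Longrightarrow> set us \<subseteq> carrier G" for us
        by (rule cl) (simp add: S subset_mset.add_increasing2)
      interpret N: comm_group "G\<lparr>carrier := H\<rparr>" by (rule comm)
      \<comment> \<open>Scherk's theorem is applied inside \<open>H\<close>, where multiplication is
        commutative. Its triviality condition holds because \<open>a \<otimes> b = \<one>\<close>
        with \<open>b\<close> in \<open>A\<close> would make \<open>us\<close> followed by a
        rotation of \<open>ys\<close> a product-one subsequence of \<open>S\<close>.\<close>
      have "card (R S') + card (insert \<one> A) \<le> card (R S' <#>\<^bsub>G\<lparr>carrier := H\<rparr>\<^esub> insert \<one> A) + 1"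
      proof (rule N.card_set_mult_ge)
        fix a b assume ab: "a \<in> R S'" "b \<in> insert \<one> A" "a \<otimes>\<^bsub>G\<lparr>carrier := H\<rparr>\<^esub> b = \<one>\<^bsub>G\<lparr>carrier := H\<rparr>\<^esub>"
        obtain us where us: "mset us \<subseteq># S'" "a = list_prod G us" using ab by (auto simp: R_def)
        have "b \<notin> A"
        proof
          assume "b \<in> A"
          then obtain i where i: "b = list_prod G (rotate i ys)" by (auto simp: A_def)
          have "list_prod G (us @ rotate i ys) = \<one>"
            using list_prod_append[OF clS'[OF us(1)] cl[OF conjunct1[OF rot]]] ab(3) us i by simp
          then show False using free'[OF comb[OF us(1), of i]] ys by simp
        qed
        then show "a = \<one>\<^bsub>G\<lparr>carrier := H\<rparr>\<^esub>"
          using ab us list_prod_closed[OF clS'[OF us(1)]] by simp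
      qed (use finR RH one_R rot in \<open>auto simp: A_def\<close>)
      moreover have "R S' <#>\<^bsub>G\<lparr>carrier := H\<rparr>\<^esub> insert \<one> A \<subseteq> R S"
      proof
        fix w assume "w \<in> R S' <#>\<^bsub>G\<lparr>carrier := H\<rparr>\<^esub> insert \<one> A"
        then obtain us b where us: "mset us \<subseteq># S'" "list_prod G us \<in> H" "b \<in> insert \<one> A"
          "w = list_prod G us \<otimes> b" by (auto simp: R_def set_mult_def)
        have "\<exists>vs. mset (us @ vs) \<subseteq># S \<and> b = list_prod G vs \<and> b \<in> H"
        proof (cases "b = \<one>")
          case True
          then show ?thesis using us(1)
            by (intro exI[of _ "[]"]) (simp add: S subset_mset.add_increasing2)
        next
          case False
          then obtain i where "b = list_prod G (rotate i ys)" using us(3) by (auto simp: A_def)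
          then show ?thesis using comb[OF us(1)] rot by blast
        qed
        then obtain vs where vs: "mset (us @ vs) \<subseteq># S" "b = list_prod G vs" "b \<in> H" by blast
        have "w = list_prod G (us @ vs)"
          using list_prod_append[of us vs] cl[OF vs(1)] us(4) vs(2) by simp
        moreover have "w \<in> H" using us vs by simp
        ultimately show "w \<in> R S" using vs(1) unfolding R_def by blast
      qed
      ultimately have "card (R S') + length ys \<le> card (R S)"
        using card_mono[OF finR[of S], of "R S' <#>\<^bsub>G\<lparr>carrier := H\<rparr>\<^esub> insert \<one> A"] cB by linarith
      moreover have "size S' + 2 \<le> card (R S') + card (rcosets H)"
      proof (rule less.hyps)
        show "size S' < size S" using ys by (simp add: S)
        show "set_mset S' \<subseteq> carrier G" using Scl by (simp add: S)
        show "product_one_free G S'" using free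
          unfolding product_one_free_def S by (meson mset_subset_eq_add_left subset_mset.trans)
      qed
      moreover have "size S = size S' + length ys" by (simp add: S)
      ultimately show ?thesis by linarith
    qed
  qed
  from this[OF assms(5,6)] show ?thesis using card_mono[OF finH RH[of S]] by linarith
qed

section \<open>Upper bound for groups satisfying the metacyclic relations\<close>

lemma (in group) pow_mult_pow_of_relation:
  fixes b k r :: nat
  assumes "a \<in> carrier G" "t \<in> carrier G" "a \<otimes> t = t \<otimes> a [^] r"
  shows "a [^] b \<otimes> t [^] k = t [^] k \<otimes> a [^] (b * r ^ k)"
proof -
  have *: "a [^] c \<otimes> t = t \<otimes> a [^] (c * r)" for c :: nat
  proof (induction c)
    case (Suc c)
    have "a [^] Suc c \<otimes> t = a [^] c \<otimes> t \<otimes> a [^] r" using assms by (simp add: m_assoc)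
    also have "\<dots> = t \<otimes> a [^] (Suc c * r)"
      using assms Suc by (simp add: m_assoc nat_pow_mult add.commute)
    finally show ?case .
  qed (use assms in simp)
  show ?thesis
  proof (induction k)
    case (Suc k)
    have "a [^] b \<otimes> t [^] Suc k = t [^] k \<otimes> a [^] (b * r ^ k) \<otimes> t"
      using assms Suc by (simp add: m_assoc[symmetric])
    also have "\<dots> = t [^] Suc k \<otimes> a [^] (b * r ^ Suc k)"
      using assms * by (simp add: m_assoc mult_ac)
    finally show ?case .
  qed (use assms in simp)
qed

lemma (in group) pow_mod_of_pow_eq_one:
  fixes b q :: nat
  assumes "a \<in> carrier G" "a [^] q = \<one>"
  shows "a [^] (b mod q) = a [^] b"
proof -
  have "a [^] b = a [^] (q * (b div q) + b mod q)" by simp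
  also have "\<dots> = a [^] (b mod q)"
    using assms by (simp only: nat_pow_mult[symmetric] nat_pow_pow[symmetric]) simp
  finally show ?thesis by simp
qed

text \<open>The general bound is used with the powers of \<open>a\<close> as subgroup; the relations
  bound its order by \<open>q\<close> and its index by \<open>n\<close>. Hypothesis \<open>r\<close>
  says that \<open>r\<close> has order exactly \<open>n\<close> modulo \<open>q\<close>, which
  yields the centraliser condition.\<close>

lemma (in group) metacyclic_product_one_free_size_le:
  fixes q n r :: nat
  assumes "prime q" "n > 0" and r: "\<And>k. [r ^ k = 1] (mod q) \<longleftrightarrow> n dvd k"
    and a: "a \<in> carrier G" "a [^] q = \<one>" and t: "t \<in> carrier G" "t [^] n = \<one>"
    and rel: "a \<otimes> t = t \<otimes> a [^] r"
    and gen: "\<And>x. x \<in> carrier G \<Longrightarrow> \<exists>(k::nat) b::nat. x = t [^] k \<otimes> a [^] b"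
    and S: "set_mset S \<subseteq> carrier G" "product_one_free G S"
  shows "size S + 2 \<le> q + n"
proof -
  have q: "q > 0" using \<open>prime q\<close> prime_gt_0_nat by blast
  define H where "H = range (\<lambda>b::nat. a [^] b)"
  have H_eq: "H = (\<lambda>b. a [^] b) ` {..<q}"
  proof
    show "H \<subseteq> (\<lambda>b. a [^] b) ` {..<q}"
    proof
      fix x assume "x \<in> H"
      then obtain b :: nat where "x = a [^] (b mod q)"
        using pow_mod_of_pow_eq_one[OF a] by (auto simp: H_def)
      then show "x \<in> (\<lambda>b. a [^] b) ` {..<q}" using q by simp
    qed
  qed (auto simp: H_def)
  have sub: "subgroup H G"
  proof (rule subgroupI)
    fix x assume "x \<in> H"
    then obtain b :: nat where b: "x = a [^] b" by (auto simp: H_def)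
    have "a [^] ((q - 1) * b) \<otimes> x = (a [^] q) [^] b"
      using a(1) q by (simp add: b nat_pow_mult nat_pow_pow algebra_simps)
    then have "inv x = a [^] ((q - 1) * b)"
      using a b by (intro inv_equality) auto
    then show "inv x \<in> H" by (simp add: H_def)
  qed (use a in \<open>auto simp: H_def nat_pow_mult\<close>)
  have conj: "x \<otimes> h \<otimes> inv x \<in> H" if xh: "x \<in> carrier G" "h \<in> H" for x h
  proof -
    obtain b :: nat where b: "h = a [^] b" using xh(2) by (auto simp: H_def)
    \<comment> \<open>The normal form is taken of \<open>inv x\<close> rather than \<open>x\<close>:
      the relation carries powers of \<open>a\<close> rightwards past powers of \<open>t\<close>, so
      \<open>h\<close> passes \<open>inv x\<close>, which then cancels against
      \<open>x\<close>.\<close>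
    obtain k c :: nat where y: "inv x = t [^] k \<otimes> a [^] c" using gen xh(1) inv_closed by blast
    have "h \<otimes> inv x = a [^] b \<otimes> t [^] k \<otimes> a [^] c" using a t by (simp add: b y m_assoc)
    also have "\<dots> = inv x \<otimes> a [^] (b * r ^ k)"
      using a t pow_mult_pow_of_relation[OF a(1) t(1) rel]
      by (simp add: y m_assoc nat_pow_mult add.commute)
    finally have "x \<otimes> h \<otimes> inv x = a [^] (b * r ^ k)"
      using xh a by (simp add: m_assoc b) (simp add: m_assoc[symmetric])
    then show ?thesis by (simp add: H_def)
  qed
  have "H \<lhd> G" using sub conj by (simp add: normal_inv_iff)
  then interpret H: normal H G .
  have "rcosets H \<subseteq> (\<lambda>k. H #> t [^] k) ` {..<n}"
  proof
    fix X assume "X \<in> rcosets H"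
    then obtain x where x: "x \<in> carrier G" "X = H #> x" by (auto simp: RCOSETS_def)
    obtain k c :: nat where k: "x = t [^] k \<otimes> a [^] c" using gen x by blast
    have "x = (t [^] k \<otimes> a [^] c \<otimes> inv (t [^] k)) \<otimes> t [^] k" using a t by (simp add: k m_assoc)
    moreover have "t [^] k \<otimes> a [^] c \<otimes> inv (t [^] k) \<in> H" using conj t by (simp add: H_def)
    ultimately have "x \<in> H #> t [^] k" by (auto simp: r_coset_def)
    then have "X = H #> t [^] k" using repr_independence sub t x by simp
    then have "X = H #> t [^] (k mod n)" using pow_mod_of_pow_eq_one[OF t] by simp
    then show "X \<in> (\<lambda>k. H #> t [^] k) ` {..<n}" using \<open>n > 0\<close> by auto
  qed
  then have index: "finite (rcosets H)" "card (rcosets H) \<le> n"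
    by (auto intro: finite_subset dest: surj_card_le[rotated])
  have cardH: "finite H" "card H \<le> q"
    unfolding H_eq by (auto intro: order_trans[OF card_image_le])
  have comm: "comm_group (G\<lparr>carrier := H\<rparr>)"
    using subgroup_imp_group[OF sub] a
    by (intro group.group_comm_groupI) (auto simp: H_def nat_pow_mult add.commute)
  have "size S + 2 \<le> card H + card (rcosets H)"
  proof (rule H.product_one_free_size_le[OF comm cardH(1) index(1) _ S])
    \<comment> \<open>If \<open>p = a [^] b\<close> commutes with
      \<open>x = t [^] k \<otimes> a [^] c\<close>, then \<open>b * r ^ k\<close> and
      \<open>b\<close> agree modulo \<open>q\<close> while \<open>q\<close> does not divide
      \<open>b\<close>. So \<open>r ^ k\<close> is 1 modulo \<open>q\<close>, \<open>n\<close>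
      divides \<open>k\<close>, and \<open>x\<close> is a power of \<open>a\<close>.\<close>
    fix p x assume p: "p \<in> H" "p \<noteq> \<one>" and x: "x \<in> carrier G" "x \<otimes> p = p \<otimes> x"
    obtain b :: nat where b: "p = a [^] b" using p by (auto simp: H_def)
    obtain k c :: nat where k: "x = t [^] k \<otimes> a [^] c" using gen x by blast
    have "p \<otimes> x = a [^] b \<otimes> t [^] k \<otimes> a [^] c" using a t by (simp add: b k m_assoc)
    also have "\<dots> = x \<otimes> a [^] (b * r ^ k)"
      using a t pow_mult_pow_of_relation[OF a(1) t(1) rel]
      by (simp add: k m_assoc nat_pow_mult add.commute)
    finally have "a [^] b = a [^] (b * r ^ k)"
      using x a b by (metis Units_eq Units_l_cancel nat_pow_closed)
    then have "a [^] (b * r ^ k - b) = \<one>" using a(1) pow_eq_div2 by metis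
    \<comment> \<open>Since its power \<open>p\<close> is nontrivial, so is \<open>a\<close>; the
      order of \<open>a\<close> divides the prime \<open>q\<close>.\<close>
    moreover have "ord a = q"
    proof -
      have "ord a dvd q" using a pow_eq_id by blast
      moreover have "ord a \<noteq> 1" using p(2) a(1) b pow_eq_id by fastforce
      ultimately show ?thesis using \<open>prime q\<close> by (auto simp: prime_nat_iff)
    qed
    ultimately have "q dvd b * r ^ k - b" using a(1) pow_eq_id by metis
    then have "q dvd b * (r ^ k - 1)" by (simp add: diff_mult_distrib2)
    moreover have "\<not> q dvd b" using p(2) b a(1) pow_eq_id \<open>ord a = q\<close> by metis
    ultimately have "q dvd r ^ k - 1" using \<open>prime q\<close> prime_dvd_mult_iff by blast
    \<comment> \<open>This makes the truncated difference \<open>r ^ k - 1\<close> a true one, so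
      that divisibility by \<open>q\<close> can be read as a congruence.\<close>
    moreover have "r > 0"
    proof (rule ccontr)
      assume "\<not> r > 0"
      then have "[0 = 1] (mod q)" using r[of n] \<open>n > 0\<close> by (simp add: power_0_left)
      then show False using \<open>prime q\<close> by (auto simp: cong_def dest: prime_gt_1_nat)
    qed
    ultimately have "[r ^ k = 1] (mod q)" by (simp add: cong_altdef_nat)
    then have "n dvd k" using r by blast
    then have "t [^] k = \<one>" using t by (metis dvdE nat_pow_one nat_pow_pow)
    then show "x \<in> H" using k a by (simp add: H_def)
  qed
  then show ?thesis using cardH index by linarith
qed

section \<open>A concrete model on pairs of residues\<close>

text \<open>The pair \<open>(k, b)\<close> stands for \<open>\<tau>\<^sup>k \<alpha>\<^sup>b\<close>.\<close>

definition metacyclic_group :: "nat \<Rightarrow> nat \<Rightarrow> nat \<Rightarrow> (nat \<times> nat) monoid" where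
  "metacyclic_group q n r =
     \<lparr>carrier = {..<n} \<times> {..<q},
      monoid.mult = (\<lambda>(k, b) (l, c). ((k + l) mod n, (b * r ^ l + c) mod q)),
      one = (0, 0)\<rparr>"

lemma cong_power_mod:
  fixes q n r k :: nat
  assumes "[r ^ n = 1] (mod q)"
  shows "[r ^ (k mod n) = r ^ k] (mod q)"
proof -
  have "r ^ k = (r ^ n) ^ (k div n) * r ^ (k mod n)"
    by (simp flip: power_mult power_add)
  moreover have "[(r ^ n) ^ (k div n) * r ^ (k mod n) = 1 ^ (k div n) * r ^ (k mod n)] (mod q)"
    using assms by (intro cong_mult cong_pow) auto
  ultimately show ?thesis by (simp add: cong_sym_eq)
qed

text \<open>The product reduces exponents of \<open>r\<close> modulo \<open>n\<close>; associativity
  survives this because \<open>r ^ n\<close> is 1 modulo \<open>q\<close>.\<close>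

lemma group_metacyclic_group:
  assumes "q > 0" "n > 0" and r: "[r ^ n = 1] (mod q)"
  shows "group (metacyclic_group q n r)"
proof (rule groupI)
  fix x y z assume "x \<in> carrier (metacyclic_group q n r)" "y \<in> carrier (metacyclic_group q n r)"
    "z \<in> carrier (metacyclic_group q n r)"
  obtain k b l c m d where xyz: "x = (k, b)" "y = (l, c)" "z = (m, d)" by (metis surj_pair)
  have "[(b * r ^ l + c) mod q * r ^ m + d = (b * r ^ l + c) * r ^ m + d] (mod q)"
    by (intro cong_add cong_mult) (auto simp: cong_def)
  also have "(b * r ^ l + c) * r ^ m + d = b * r ^ (l + m) + (c * r ^ m + d)"
    by (simp add: algebra_simps power_add)
  also have "[\<dots> = b * r ^ ((l + m) mod n) + (c * r ^ m + d) mod q] (mod q)"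
    by (intro cong_add cong_mult cong_sym[OF cong_power_mod[OF r]]) (auto simp: cong_def)
  finally show "x \<otimes>\<^bsub>metacyclic_group q n r\<^esub> y \<otimes>\<^bsub>metacyclic_group q n r\<^esub> z
    = x \<otimes>\<^bsub>metacyclic_group q n r\<^esub> (y \<otimes>\<^bsub>metacyclic_group q n r\<^esub> z)"
    by (simp add: xyz metacyclic_group_def cong_def mod_simps add.assoc)
next
  fix x assume x: "x \<in> carrier (metacyclic_group q n r)"
  obtain k b where kb: "x = (k, b)" by (metis surj_pair)
  have lt: "k < n" "b < q" using x by (auto simp: kb metacyclic_group_def)
  \<comment> \<open>The inverse of \<open>(k, b)\<close> is \<open>(-k, -b r^(-k))\<close>, with
    \<open>n - k\<close> and \<open>q - b\<close> in place of the negatives. The witness below also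
    reduces its first coordinate, for the case \<open>k = 0\<close>.\<close>
  have "(q - b) * r ^ (n - k) * r ^ k + b = (q - b) * r ^ n + b"
    using lt by (simp flip: power_add)
  moreover have "[(q - b) * r ^ n + b = (q - b) * 1 + b] (mod q)"
    using r by (intro cong_add cong_mult) auto
  moreover have "[(q - b) * r ^ (n - k) mod q * r ^ k + b = (q - b) * r ^ (n - k) * r ^ k + b] (mod q)"
    by (intro cong_add cong_mult) (auto simp: cong_def)
  ultimately have "((q - b) * r ^ (n - k) mod q * r ^ k + b) mod q = 0"
    using lt unfolding cong_def by (metis le_add_diff_inverse2 less_imp_le mod_self mult.right_neutral)
  then show "\<exists>y\<in>carrier (metacyclic_group q n r).
      y \<otimes>\<^bsub>metacyclic_group q n r\<^esub> x = \<one>\<^bsub>metacyclic_group q n r\<^esub>"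
    using assms lt
    by (intro bexI[of _ "((n - k) mod n, (q - b) * r ^ (n - k) mod q)"])
      (auto simp: kb metacyclic_group_def mod_simps)
qed (use assms in \<open>auto simp: metacyclic_group_def\<close>)

section \<open>The presented group: normal form and map to the model\<close>

text \<open>For \<open>n = 4\<close> these are the relations in \<open>G_pres\<close>.\<close>

definition metacyclic_rels :: "nat \<Rightarrow> nat \<Rightarrow> nat \<Rightarrow> (gens gword \<times> gens gword) set" where
  "metacyclic_rels q n r =
     {(gpow Alpha q, []), (gpow Tau n, []),
      (gpow Alpha 1 @ gpow Tau 1, gpow Tau 1 @ gpow Alpha r)}"

lemma pres_class_gpow:
  "pres_class R (gpow x n) = pres_class R (gpow x 1) [^]\<^bsub>presented_group R\<^esub> n"
proof (induction n)
  case 0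
  interpret group "presented_group R" by (rule group_presented_group)
  show ?case by (simp add: gpow_def presented_group_one)
next
  case (Suc n)
  interpret group "presented_group R" by (rule group_presented_group)
  have "gpow x (Suc n) = gpow x n @ gpow x 1" by (simp add: gpow_def replicate_append_same)
  then show ?case using Suc by (simp add: presented_group_mult[symmetric])
qed

text \<open>These are the facts that the upper bound consumes. The normal form follows by prepending
  letters: a power of \<open>a\<close> is carried past \<open>t [^] k\<close> by the
  relation.\<close>

lemma presented_metacyclic_normal_form:
  fixes q n r :: nat
  defines "R \<equiv> metacyclic_rels q n r"
  defines "G \<equiv> presented_group R"
  defines "a \<equiv> pres_class R (gpow Alpha 1)" and "t \<equiv> pres_class R (gpow Tau 1)"
  assumes "q > 0" "n > 0"
  shows "a \<in> carrier G" "t \<in> carrier G" "a [^]\<^bsub>G\<^esub> q = \<one>\<^bsub>G\<^esub>" "t [^]\<^bsub>G\<^esub> n = \<one>\<^bsub>G\<^esub>"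
    "a \<otimes>\<^bsub>G\<^esub> t = t \<otimes>\<^bsub>G\<^esub> a [^]\<^bsub>G\<^esub> r"
    "x \<in> carrier G \<Longrightarrow> \<exists>(k::nat) b::nat. x = t [^]\<^bsub>G\<^esub> k \<otimes>\<^bsub>G\<^esub> a [^]\<^bsub>G\<^esub> b"
proof -
  interpret group G unfolding G_def by (rule group_presented_group)
  have rels: "pres_class R u = pres_class R v" if "(u, v) \<in> R" for u v
    using pres_eq.relation[OF that, of "[]" "[]"] by (simp add: pres_class_eq_iff)
  note pow = pres_class_gpow[of R, folded G_def] and mult = presented_group_mult[of R, folded G_def]
    and one = presented_group_one[of R, folded G_def]
  show a: "a \<in> carrier G" and t: "t \<in> carrier G"
    by (auto simp: a_def t_def G_def presented_group_carrier)
  have "pres_class R (gpow Alpha q) = pres_class R []"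
    by (rule rels) (simp add: R_def metacyclic_rels_def)
  then show aq: "a [^]\<^bsub>G\<^esub> q = \<one>\<^bsub>G\<^esub>" by (simp only: pow[of Alpha q] one a_def)
  have "pres_class R (gpow Tau n) = pres_class R []"
    by (rule rels) (simp add: R_def metacyclic_rels_def)
  then show tn: "t [^]\<^bsub>G\<^esub> n = \<one>\<^bsub>G\<^esub>" by (simp only: pow[of Tau n] one t_def)
  have "pres_class R (gpow Alpha 1 @ gpow Tau 1) = pres_class R (gpow Tau 1 @ gpow Alpha r)"
    by (rule rels) (simp add: R_def metacyclic_rels_def)
  then show rel: "a \<otimes>\<^bsub>G\<^esub> t = t \<otimes>\<^bsub>G\<^esub> a [^]\<^bsub>G\<^esub> r"
    by (simp only: mult[symmetric] pow[of Alpha r] a_def t_def)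
  \<comment> \<open>Finite order turns inverse letters into natural powers of the generators, so
    natural exponents suffice throughout.\<close>
  have inv: "inv\<^bsub>G\<^esub> x = x [^]\<^bsub>G\<^esub> (m - 1)" if "x \<in> carrier G" "x [^]\<^bsub>G\<^esub> m = \<one>\<^bsub>G\<^esub>" "m > 0" for x and m :: nat
  proof (rule inv_equality)
    show "x [^]\<^bsub>G\<^esub> (m - 1) \<otimes>\<^bsub>G\<^esub> x = \<one>\<^bsub>G\<^esub>" using that by (metis Suc_pred' nat_pow_Suc)
  qed (use that in auto)
  have letter: "\<exists>m::nat. pres_class R [(y, e)] = pres_class R (gpow y 1) [^]\<^bsub>G\<^esub> m" for y e
  proof (cases e)
    case True
    then show ?thesis using a t
      by (intro exI[of _ 1]) (cases y; simp add: gpow_def a_def t_def)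
  next
    case False
    have "pres_class R [(y, e)] \<otimes>\<^bsub>G\<^esub> pres_class R (gpow y 1) = \<one>\<^bsub>G\<^esub>"
      using pres_eq.cancel[of R "[]" y False "[]"] False
      by (simp add: mult one pres_class_eq_iff gpow_def)
    then have "pres_class R [(y, e)] = inv\<^bsub>G\<^esub> pres_class R (gpow y 1)"
      by (intro inv_equality[symmetric]) (auto simp: G_def presented_group_carrier)
    then show ?thesis using inv[OF a aq \<open>q > 0\<close>] inv[OF t tn \<open>n > 0\<close>]
      by (cases y) (auto simp: a_def t_def)
  qed
  have nf: "\<exists>(k::nat) b::nat. pres_class R w = t [^]\<^bsub>G\<^esub> k \<otimes>\<^bsub>G\<^esub> a [^]\<^bsub>G\<^esub> b" for w
  proof (induction w)
    case Nil
    show ?case by (intro exI[of _ 0]) (simp flip: one)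
  next
    case (Cons z w)
    obtain y e where z: "z = (y, e)" by (cases z)
    obtain k b :: nat where w: "pres_class R w = t [^]\<^bsub>G\<^esub> k \<otimes>\<^bsub>G\<^esub> a [^]\<^bsub>G\<^esub> b" using Cons by blast
    obtain m :: nat where m: "pres_class R [(y, e)] = pres_class R (gpow y 1) [^]\<^bsub>G\<^esub> m"
      using letter by blast
    have zw: "pres_class R (z # w) = pres_class R (gpow y 1) [^]\<^bsub>G\<^esub> m \<otimes>\<^bsub>G\<^esub> (t [^]\<^bsub>G\<^esub> k \<otimes>\<^bsub>G\<^esub> a [^]\<^bsub>G\<^esub> b)"
      using mult[of "[z]" w] by (simp add: z w m)
    show ?case
    proof (cases y)
      case Alpha
      have "pres_class R (z # w) = a [^]\<^bsub>G\<^esub> m \<otimes>\<^bsub>G\<^esub> t [^]\<^bsub>G\<^esub> k \<otimes>\<^bsub>G\<^esub> a [^]\<^bsub>G\<^esub> b"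
        using zw a t unfolding Alpha a_def[symmetric] by (simp add: m_assoc)
      also have "\<dots> = t [^]\<^bsub>G\<^esub> k \<otimes>\<^bsub>G\<^esub> a [^]\<^bsub>G\<^esub> (m * r ^ k + b)"
        using a t by (simp add: pow_mult_pow_of_relation[OF a t rel] m_assoc nat_pow_mult)
      finally show ?thesis by blast
    next
      case Tau
      have "pres_class R (z # w) = t [^]\<^bsub>G\<^esub> (m + k) \<otimes>\<^bsub>G\<^esub> a [^]\<^bsub>G\<^esub> b"
        using zw a t unfolding Tau t_def[symmetric] by (simp add: m_assoc[symmetric] nat_pow_mult)
      then show ?thesis by blast
    qed
  qed
  show "\<exists>(k::nat) b::nat. x = t [^]\<^bsub>G\<^esub> k \<otimes>\<^bsub>G\<^esub> a [^]\<^bsub>G\<^esub> b" if "x \<in> carrier G"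
    using that nf by (auto simp: G_def presented_group_carrier)
qed

text \<open>This guards against collapse of the presented group: the images in the model detect that
  certain products are not trivial.\<close>

lemma presented_metacyclic_hom:
  fixes q n r :: nat
  defines "R \<equiv> metacyclic_rels q n r"
  assumes "q > 1" "n > 0" and r: "[r ^ n = 1] (mod q)"
  shows "\<exists>h \<in> hom (presented_group R) (metacyclic_group q n r).
    h (pres_class R (gpow Alpha 1)) = (0, 1) \<and> h (pres_class R (gpow Tau 1)) = (1 mod n, 0)"
proof -
  let ?M = "metacyclic_group q n r"
  \<comment> \<open>Writing \<open>1 mod n\<close> keeps the image of \<open>Tau\<close> in the
    carrier for \<open>n = 1\<close>, where it is the identity.\<close>
  define f :: "gens \<Rightarrow> nat \<times> nat"
    where "f x = (case x of Alpha \<Rightarrow> (0, 1) | Tau \<Rightarrow> (1 mod n, 0))" for x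
  have grp: "group ?M" using assms by (intro group_metacyclic_group) auto
  have f: "f x \<in> carrier ?M" for x
    using assms by (cases x) (auto simp: f_def metacyclic_group_def)
  have alpha: "eval_gword ?M f (gpow Alpha j) = (0, j mod q)" for j
    by (induction j) (auto simp: eval_gword_def gpow_def metacyclic_group_def f_def mod_simps)
  have tau: "eval_gword ?M f (gpow Tau j) = (j mod n, 0)" for j
    by (induction j) (auto simp: eval_gword_def gpow_def metacyclic_group_def f_def mod_simps)
  have "eval_gword ?M f u = eval_gword ?M f v" if "(u, v) \<in> R" for u v
  proof -
    have nil: "eval_gword ?M f [] = (0, 0)" by (simp add: eval_gword_def metacyclic_group_def)
    have "r ^ (1 mod n) mod q = r mod q" using cong_power_mod[OF r, of 1] by (simp add: cong_def)
    then have "eval_gword ?M f (gpow Alpha 1 @ gpow Tau 1)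
        = eval_gword ?M f (gpow Tau 1 @ gpow Alpha r)"
      using assms by (simp only: eval_gword_append[OF grp f] alpha tau) (simp add: metacyclic_group_def mod_simps)
    then show ?thesis
      using that alpha[of q] tau[of n] nil by (auto simp: R_def metacyclic_rels_def)
  qed
  then obtain h where h: "h \<in> hom (presented_group R) ?M" "\<And>w. h (pres_class R w) = eval_gword ?M f w"
    using presented_group_universal[of ?M f R, OF grp f] by blast
  show ?thesis using h alpha[of 1] tau[of 1] \<open>q > 1\<close> by (intro bexI[of _ h]) auto
qed

section \<open>The value of the small Davenport constant\<close>

theorem small_davenport_metacyclic:
  fixes q n r :: nat
  assumes "prime q" "n > 0" and r: "\<And>k. [r ^ k = 1] (mod q) \<longleftrightarrow> n dvd k"
  shows "small_davenport (presented_group (metacyclic_rels q n r)) = q + n - 2"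
proof -
  define R where "R = metacyclic_rels q n r"
  define G where "G = presented_group R"
  define a t where "a = pres_class R (gpow Alpha 1)" and "t = pres_class R (gpow Tau 1)"
  have q: "q > 1" "q > 0" using prime_gt_1_nat[OF assms(1)] by auto
  interpret group G unfolding G_def by (rule group_presented_group)
  note nf = presented_metacyclic_normal_form[where r = r, OF q(2) \<open>n > 0\<close>, folded R_def, folded G_def a_def t_def]
  obtain h where h: "h \<in> hom G (metacyclic_group q n r)" "h a = (0, 1)" "h t = (1 mod n, 0)"
    using presented_metacyclic_hom[where r = r, OF q(1) \<open>n > 0\<close>, folded R_def, folded G_def a_def t_def] r[of n]
    by auto
  have "group (metacyclic_group q n r)" using q assms by (intro group_metacyclic_group) auto
  then have h_one: "h \<one>\<^bsub>G\<^esub> = (0, 0)"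
    using hom_one[OF h(1) is_group] by (simp add: metacyclic_group_def)
  have h_mult: "h (x \<otimes>\<^bsub>G\<^esub> y) = h x \<otimes>\<^bsub>metacyclic_group q n r\<^esub> h y" if "x \<in> carrier G" "y \<in> carrier G" for x y
    using h(1) that by (simp add: hom_def)
  have "a \<noteq> t" using h by auto
  define S where "S = replicate_mset (q - 1) a + replicate_mset (n - 1) t"
  have fst_h: "fst (h (list_prod G xs)) = count (mset xs) t mod n" if "set xs \<subseteq> {a, t}" for xs
    using that
  proof (induction xs)
    case (Cons x xs)
    have "list_prod G xs \<in> carrier G" using Cons.prems nf(1,2) by (intro list_prod_closed) auto
    then show ?case using Cons nf(1,2) h \<open>a \<noteq> t\<close>
      by (cases "h (list_prod G xs)") (auto simp: h_mult metacyclic_group_def mod_simps)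
  qed (simp add: h_one)
  have h_pow: "h (list_prod G (replicate j a)) = (0, j mod q)" for j
  proof (induction j)
    case (Suc j)
    have "list_prod G (replicate j a) \<in> carrier G" using nf(1) by (intro list_prod_closed) auto
    then show ?case using Suc nf(1) h(2) by (simp add: h_mult metacyclic_group_def mod_simps)
  qed (simp add: h_one)
  \<comment> \<open>In any order of the terms, the first coordinate under \<open>h\<close> counts
    the copies of \<open>t\<close> modulo \<open>n\<close>. At most \<open>n - 1\<close> are
    available, so a product-one subsequence has none. It consists of fewer than \<open>q\<close>
    copies of \<open>a\<close>, and the second coordinate shows that it is empty.\<close>
  have "product_one_free G S"
    unfolding product_one_free_def product_one_def
  proof (intro allI impI notI, elim conjE exE)
    fix T xs assume T: "T \<subseteq># S" "T \<noteq> {#}" and xs: "mset xs = T" "list_prod G xs = \<one>\<^bsub>G\<^esub>"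
    have "set_mset T \<subseteq> set_mset S" using T(1) by (rule set_mset_mono)
    then have set: "set xs \<subseteq> {a, t}" using xs(1) by (auto simp: S_def split: if_splits)
    have "count T t \<le> n - 1" "count T a \<le> q - 1"
      using mset_subset_eq_count[OF T(1), of t] mset_subset_eq_count[OF T(1), of a] \<open>a \<noteq> t\<close>
      by (simp_all add: S_def)
    moreover have "count T t mod n = 0" using fst_h[OF set] xs h_one by simp
    ultimately have "count T t = 0" using \<open>n > 0\<close> by simp
    then have "set xs \<subseteq> {a}" using set xs(1) by (auto simp: count_eq_zero_iff)
    then have rep: "xs = replicate (length xs) a" by (metis replicate_eqI singletonD subsetD)
    then have "count T a = length xs" using xs(1) by (metis count_replicate_mset mset_replicate)
    moreover have "length xs mod q = 0" using h_pow[of "length xs"] rep xs(2) h_one by simp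
    ultimately have "xs = []" using \<open>count T a \<le> q - 1\<close> q by simp
    then show False using T(2) xs(1) by simp
  qed
  moreover have "size S = q + n - 2" "set_mset S \<subseteq> carrier G"
    using q \<open>n > 0\<close> nf(1,2) by (auto simp: S_def split: if_splits)
  moreover have "size S' \<le> q + n - 2" if "set_mset S' \<subseteq> carrier G" "product_one_free G S'" for S'
    using metacyclic_product_one_free_size_le[OF assms nf(1,3,2,4,5,6) that] by simp
  ultimately have "small_davenport G = q + n - 2"
    unfolding small_davenport_def by (intro Greatest_equality) blast+
  then show ?thesis by (simp add: G_def R_def)
qed

theorem theorem6p1:
  fixes q r :: nat
  assumes "prime q" and "odd q"
    and "r \<in> {1..q - 1}"
    and "[(int r)\<^sup>2 = - 1] (mod int q)"
  shows "small_davenport (G_pres q r) = q + 2"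
proof -
  have q: "q > 2" using assms(1,2) prime_ge_2_nat[of q] by (cases "q = 2") auto
  have "[((int r)\<^sup>2)\<^sup>2 = (- 1)\<^sup>2] (mod int q)" using assms(4) by (rule cong_pow)
  then have "[int (r ^ 4) = int 1] (mod int q)" by (simp flip: power_mult)
  then have r4: "[r ^ 4 = 1] (mod q)" by (simp only: cong_int_iff)
  \<comment> \<open>Otherwise -1 and 1 agree modulo \<open>q\<close>, so \<open>q\<close> divides 2.
    Together with \<open>r4\<close> this makes the order of \<open>r\<close> exactly 4.\<close>
  have r2: "\<not> [r\<^sup>2 = 1] (mod q)"
  proof
    assume "[r\<^sup>2 = 1] (mod q)"
    then have "[int (r\<^sup>2) = int 1] (mod int q)" by (simp only: cong_int_iff)
    then have "[- 1 = 1] (mod int q)" using assms(4) by (metis cong_sym cong_trans of_nat_1 of_nat_power)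
    then have "int q dvd 2" by (simp add: cong_iff_dvd_diff)
    then show False using q zdvd_imp_le by fastforce
  qed
  have "[r ^ k = 1] (mod q) \<longleftrightarrow> 4 dvd k" for k
  proof
    assume "4 dvd k"
    then show "[r ^ k = 1] (mod q)" using cong_power_mod[OF r4, of k] by (simp add: cong_sym_eq)
  next
    assume "[r ^ k = 1] (mod q)"
    then have k: "[r ^ (k mod 4) = 1] (mod q)" using cong_power_mod[OF r4, of k] cong_trans by blast
    \<comment> \<open>Doubling sends the remainders 1 and 3 to 2 modulo 4, so every nonzero
      remainder contradicts \<open>r2\<close>.\<close>
    then have "[r ^ (k mod 4 * 2) = 1] (mod q)" using cong_pow[OF k, of 2] by (simp add: power_mult)
    then have "[r ^ (k mod 4 * 2 mod 4) = 1] (mod q)" 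
      using cong_power_mod[OF r4, of "k mod 4 * 2"] cong_trans by blast
    moreover have "k mod 4 = 0 \<or> k mod 4 = 1 \<or> k mod 4 = 2 \<or> k mod 4 = 3" by linarith
    ultimately show "4 dvd k" using k r2 by auto
  qed
  from small_davenport_metacyclic[OF assms(1) _ this] show ?thesis
    by (simp add: G_pres_def metacyclic_rels_def)
qed

end
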